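(* Let $\mathbb{A} = \{a_1, a_2, \ldots, a_k\}_{\vec r}$ be a sequence of positive integers with $a_1 < a_2 < \cdots < a_k$, $\vec r = (r_1, \ldots, r_k)$ and $r_i \geq 2$ for all $i \in [1,k]$. Let $A = \{a_1,\ldots,a_k\}$, suppose $d(A) = 1$, and let $r = \min\{r_1, \ldots, r_k\}$. Then \[ |S(\mathbb{A})| \geq |(r-1)(A \cup \{0\})| + \min\{a_k, r(k-1)+1\} - 1 + \sum_{i=1}^{k-1} i r_i + k(r_k - r). \]
   Context: The notation $\mathbb{A} = \{a_1, \ldots, a_k\}_{\vec r}$ with $\vec r = (r_1,\ldots,r_k)$ means $\mathbb{A}$ is a finite sequence consisting of the $k$ distinct integers $a_1,\ldots,a_k$, where $a_i$ appears exactly $r_i$ times. $S(\mathbb{A}) = \{\sum_{b \in \mathbb{B}} b : \mathbb{B} \text{ a nonempty subsequence of } \mathbb{A}\}$. For a finite set $X$ of integers and $h \geq 1$, $hX$ is the $h$-fold sumset, the set of all sums of $h$ (not necessarily distinct) elements of $X$. $d(A)$ is the greatest common divisor of the elements of $A$. *)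

theory Defs
  imports Complex_Main "HOL-Library.Sublist"
begin

(* The order of the terms of AA is left open; only the multiplicities are prescribed. *)
definition seq_with_mult :: "int list \<Rightarrow> nat \<Rightarrow> (nat \<Rightarrow> int) \<Rightarrow> (nat \<Rightarrow> nat) \<Rightarrow> bool" where
  "seq_with_mult AA k a r \<longleftrightarrow>
     inj_on a {1..k} \<and> set AA = a ` {1..k} \<and> (\<forall>i\<in>{1..k}. count_list AA (a i) = r i)"

(* subseq is the library's relation for not necessarily contiguous subsequences. *)
definition subseq_sums :: "int list \<Rightarrow> int set" where
  "subseq_sums AA = {sum_list BB | BB. subseq BB AA \<and> BB \<noteq> []}"

definition sumset_fold :: "nat \<Rightarrow> int set \<Rightarrow> int set" where
  "sumset_fold h X = {sum_list xs | xs. length xs = h \<and> set xs \<subseteq> X}"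

end

theory Submission
  imports Defs "HOL-Library.Set_Algebras"
begin

text \<open>
  Write \<open>B = A \<union> {0}\<close> and \<open>\<Sigma> = S(\<AA>) \<union> {0}\<close>, where \<open>\<AA>\<close> is the given sequence.
  All of \<open>rB\<close> lies in \<open>\<Sigma> \<inter> [0, r a\<^sub>k]\<close>, and climbing from \<open>r a\<^sub>k\<close> to the full sum, using up the
  copies of \<open>a\<^sub>k\<close>, then those of \<open>a\<^sub>k\<^sub>-\<^sub>1\<close>, and so on, gains \<open>j\<close> new sums with every copy of
  \<open>a\<^sub>j\<close>. This reduces the claim to Lev's inequality
  \<open>|hB| \<ge> |(h-1)B| + min {l, h(k-1)+1}\<close> with \<open>l = a\<^sub>k\<close>.

  For the latter, let \<open>G\<close> be the image of \<open>hB\<close> modulo \<open>l\<close> and \<open>H\<close> its stabilizer. The largest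
  element of \<open>hB\<close> in a residue class is not in \<open>(h-1)B\<close>, as otherwise \<open>l\<close> could be added, so
  \<open>hB - (h-1)B\<close> maps onto \<open>G\<close>. If \<open>G\<close> is not everything, some coset of \<open>H\<close> in \<open>G\<close> avoids
  \<open>(h-1)B\<close>; there \<open>hB\<close> contains a sumset of \<open>h\<close> sets of integers, whose size compensates exactly for
  the loss in Kneser's bound for \<open>|G|\<close> when \<open>H\<close> is nontrivial.
\<close>

section \<open>Kneser's theorem\<close>

definition stab :: "'a::ab_group_add set \<Rightarrow> 'a set" where
  "stab C = {h. \<forall>c. h + c \<in> C \<longleftrightarrow> c \<in> C}"

lemma stabD: "h \<in> stab C \<Longrightarrow> h + c \<in> C \<longleftrightarrow> c \<in> C"
  by (simp add: stab_def)

lemma zero_in_stab: "0 \<in> stab C"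
  by (simp add: stab_def)

lemma add_in_stab: "g \<in> stab C \<Longrightarrow> h \<in> stab C \<Longrightarrow> g + h \<in> stab C"
  by (simp add: stab_def add.assoc)

lemma minus_in_stab: "h \<in> stab C \<Longrightarrow> - h \<in> stab C"
  using stabD[of h C "- h + c" for c] by (auto simp: stab_def)

lemma diff_in_stab: "g \<in> stab C \<Longrightarrow> h \<in> stab C \<Longrightarrow> g - h \<in> stab C"
  using add_in_stab[OF _ minus_in_stab, of g C h] by simp

text \<open>Translation is injective, so for finite \<open>C\<close> the inclusion of
  \<open>h + C\<close> in \<open>C\<close> is already an equality.\<close>

lemma stabI:
  assumes "finite C" "\<And>c. c \<in> C \<Longrightarrow> h + c \<in> C"
  shows "h \<in> stab C"
proof -
  have "(+) h ` C \<subseteq> C" using assms(2) by blast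
  then have eq: "(+) h ` C = C"
    by (rule card_subset_eq[OF assms(1)]) (simp add: card_image)
  have "c \<in> C" if "h + c \<in> C" for c
  proof -
    have "h + c \<in> (+) h ` C" using that eq by simp
    then show ?thesis by auto
  qed
  then show ?thesis
    using assms(2) unfolding stab_def by blast
qed

lemma finite_stab:
  assumes "finite C" "C \<noteq> {}"
  shows "finite (stab C)"
proof -
  obtain c where "c \<in> C" using assms(2) by blast
  then have "h \<in> (\<lambda>x. x - c) ` C" if "h \<in> stab C" for h
    using stabD[OF that, of c] by (intro image_eqI[of _ _ "h + c"]) auto
  then show ?thesis
    using assms(1) by (meson finite_imageI finite_subset subsetI)
qed

lemma card_coset: "card ((+) x ` H) = card H" for H :: "'a::ab_group_add set"
  by (simp add: card_image)

lemma card_le_of_stab_subset: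
  fixes X H :: "'a::ab_group_add set"
  assumes "finite X" "x \<in> X" "\<And>h. h \<in> H \<Longrightarrow> h + x \<in> X"
  shows "card H \<le> card X"
proof (rule card_inj_on_le[of "\<lambda>h. h + x"])
  show "inj_on (\<lambda>h. h + x) H" by (simp add: inj_on_def)
qed (use assms in auto)

section \<open>Unions of sets and their stabilizers\<close>

lemma card_mult_le_fibres:
  assumes "finite X" "\<And>z. z \<in> f ` X \<Longrightarrow> card {p \<in> X. f p = z} \<le> m"
  shows "card X \<le> m * card (f ` X)"
proof -
  have "card X = card (\<Union>z\<in>f ` X. {p \<in> X. f p = z})"
    by (rule arg_cong[of _ _ card]) auto
  also have "\<dots> \<le> (\<Sum>z\<in>f ` X. card {p \<in> X. f p = z})"
    using assms(1) by (intro card_UN_le) auto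
  also have "\<dots> \<le> card (f ` X) * m"
    using sum_bounded_above[of "f ` X" "\<lambda>z. card {p \<in> X. f p = z}" m] assms(2) by simp
  finally show ?thesis by (simp add: mult.commute)
qed

text \<open>If \<open>u + v = u0 + v0\<close>, then \<open>u - u0 = v0 - v\<close> lies in both
  stabilizers. So each value of \<open>u + v - x\<close> has at most
  \<open>card (stab C1 \<inter> stab C2)\<close> representations.\<close>

lemma card_mult_le_stab_Int:
  fixes C1 C2 :: "'a::ab_group_add set"
  assumes fin: "finite (stab C1)" "finite (stab C2)"
    and U: "U \<subseteq> (+) x ` stab C1" and V: "V \<subseteq> (+) x ` stab C2"
    and W: "finite W" "\<And>u v. u \<in> U \<Longrightarrow> v \<in> V \<Longrightarrow> u + v - x \<in> W"
  shows "card U * card V \<le> card (stab C1 \<inter> stab C2) * card W"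
proof -
  have finUV: "finite U" "finite V"
    using fin U V by (auto intro: finite_subset)
  let ?f = "\<lambda>(u, v). u + v - x"
  have "card (U \<times> V) \<le> card (stab C1 \<inter> stab C2) * card (?f ` (U \<times> V))"
  proof (rule card_mult_le_fibres)
    show "finite (U \<times> V)" using finUV by simp
  next
    fix z assume "z \<in> ?f ` (U \<times> V)"
    then obtain u0 v0 where 0: "u0 \<in> U" "v0 \<in> V" "z = u0 + v0 - x" by auto
    show "card {p \<in> U \<times> V. ?f p = z} \<le> card (stab C1 \<inter> stab C2)"
    proof (rule card_inj_on_le[of "\<lambda>(u, v). u - u0"])
      show "inj_on (\<lambda>(u, v). u - u0) {p \<in> U \<times> V. ?f p = z}"
      proof (rule inj_onI)
        fix s t
        assume s: "s \<in> {p \<in> U \<times> V. ?f p = z}" and t: "t \<in> {p \<in> U \<times> V. ?f p = z}"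
          and eq: "(case s of (u, v) \<Rightarrow> u - u0) = (case t of (u, v) \<Rightarrow> u - u0)"
        have "fst s = fst t" using eq by (simp add: case_prod_unfold)
        moreover have "fst s + snd s - x = fst t + snd t - x"
          using s t by (simp add: case_prod_unfold)
        ultimately show "s = t" by (simp add: prod_eq_iff)
      qed
      show "(\<lambda>(u, v). u - u0) ` {p \<in> U \<times> V. ?f p = z} \<subseteq> stab C1 \<inter> stab C2"
      proof (rule image_subsetI)
        fix s assume "s \<in> {p \<in> U \<times> V. ?f p = z}"
        then obtain u v where s: "s = (u, v)" and uv: "u \<in> U" "v \<in> V" "u + v - x = z" by auto
        then have "u - u0 = v0 - v" using 0 by (simp add: algebra_simps)
        moreover have "u - u0 \<in> stab C1"
        proof -
          obtain g h where "g \<in> stab C1" "h \<in> stab C1" "u = x + g" "u0 = x + h"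
            using uv 0 U by blast
          then show ?thesis by (simp add: diff_in_stab)
        qed
        moreover have "v0 - v \<in> stab C2"
        proof -
          obtain g h where "g \<in> stab C2" "h \<in> stab C2" "v0 = x + g" "v = x + h"
            using uv 0 V by blast
          then show ?thesis by (simp add: diff_in_stab)
        qed
        ultimately show "(case s of (u, v) \<Rightarrow> u - u0) \<in> stab C1 \<inter> stab C2" using s by simp
      qed
      show "finite (stab C1 \<inter> stab C2)" using fin by simp
    qed
  qed
  also have "\<dots> \<le> card (stab C1 \<inter> stab C2) * card W"
    using W by (intro mult_le_mono2 card_mono) auto
  finally show ?thesis by (simp add: card_cartesian_product)
qed

text \<open>From \<open>(p - k) * (q - k) \<ge> 0\<close> follows
  \<open>k * (p + q - k) \<le> p * q\<close>. If both alternatives fail, multiplying this for the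
  two pairs contradicts the product of the two bounds.\<close>

lemma grid_count_arith:
  fixes k p1 q1 p2 q2 x y :: nat
  assumes "k > 0" "p1 * q2 \<le> k * x" "q1 * p2 \<le> k * y"
    and "k \<le> p1" "k \<le> q1" "k \<le> p2" "k \<le> q2"
  shows "p2 + q2 \<le> x + k \<or> p1 + q1 \<le> y + k"
proof (rule ccontr)
  assume "\<not> ?thesis"
  then have lt: "x < p2 + q2 - k" "y < p1 + q1 - k" by auto
  have pq: "k * (p + q - k) \<le> p * q" if kp: "k \<le> p" and kq: "k \<le> q" for p q :: nat
  proof -
    obtain u v where "p = k + u" "q = k + v" using le_Suc_ex[OF kp] le_Suc_ex[OF kq] by blast
    then show ?thesis by (simp add: algebra_simps)
  qed
  have "(k * (p1 + q1 - k)) * (k * (p2 + q2 - k)) \<le> (p1 * q1) * (p2 * q2)"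
    by (rule mult_le_mono[OF pq[OF assms(4,5)] pq[OF assms(6,7)]])
  also have "\<dots> = (p1 * q2) * (q1 * p2)" by (simp add: ac_simps)
  also have "\<dots> \<le> (k * x) * (k * y)" by (rule mult_le_mono[OF assms(2,3)])
  finally have "(k * k) * ((p2 + q2 - k) * (p1 + q1 - k)) \<le> (k * k) * (x * y)"
    by (simp add: ac_simps)
  moreover have "x * y < (p2 + q2 - k) * (p1 + q1 - k)"
    using lt by (intro mult_strict_mono) auto
  ultimately show False using \<open>k > 0\<close> by simp
qed

text \<open>Fix \<open>x \<in> C1 - C2\<close>. Sums of a point of \<open>x + stab C1\<close> outside \<open>C2\<close> and a point of \<open>x + stab C2\<close>
  inside \<open>C1\<close>, translated back by \<open>x\<close>, lie in \<open>C1 - C2\<close>; exchanging inside and outside gives points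
  of \<open>C2 - C1\<close>. Each point arises at most \<open>k\<close> times.\<close>

lemma card_union_stab_aux:
  fixes C1 C2 :: "'a::ab_group_add set"
  assumes fin: "finite C1" "finite C2" and ne: "C2 \<noteq> {}" and nsub: "\<not> C1 \<subseteq> C2"
    and le: "card (stab C2) \<le> card (stab C1)"
  defines "k \<equiv> card (stab C1 \<inter> stab C2)"
  shows "card (stab C2) \<le> card (C1 - C2) + k \<or> card (stab C1) \<le> card (C2 - C1) + k"
proof -
  have ne1: "C1 \<noteq> {}" using nsub by blast
  have finS: "finite (stab C1)" "finite (stab C2)"
    using fin ne ne1 by (auto intro: finite_stab)
  obtain x where x: "x \<in> C1" "x \<notin> C2" using nsub by blast
  let ?D1 = "(+) x ` stab C1" and ?D2 = "(+) x ` stab C2"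
  \<comment> \<open>\<open>p1\<close> and \<open>q1\<close> count the parts of
    \<open>x + stab C1\<close> outside and inside \<open>C2\<close>; \<open>p2\<close> and
    \<open>q2\<close> do the same for \<open>x + stab C2\<close> and \<open>C1\<close>.\<close>
  define p1 where "p1 = card (?D1 - C2)"
  define q1 where "q1 = card (?D1 \<inter> C2)"
  define p2 where "p2 = card (?D2 - C1)"
  define q2 where "q2 = card (?D2 \<inter> C1)"
  have "card ?D1 = q1 + p1" "card ?D2 = q2 + p2"
    unfolding p1_def p2_def q1_def q2_def using finS by (auto intro!: card_Int_Diff)
  then have m: "card (stab C1) = p1 + q1" "card (stab C2) = p2 + q2"
    by (simp_all add: card_coset)
  have kpos: "k > 0"
    unfolding k_def using finS zero_in_stab by (subst card_gt_0_iff) blast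
  have step: "h + (x + g) \<in> (+) x ` S" if "h \<in> S" "g \<in> S" "S = stab C" for h g S and C :: "'a set"
    using that add_in_stab[of h C g] by (auto simp: algebra_simps image_iff intro: bexI[of _ "h + g"])
  have coset: "k \<le> card X" if nonempty: "X \<noteq> {}" and "finite X" and
      "\<And>h y. h \<in> stab C1 \<Longrightarrow> h \<in> stab C2 \<Longrightarrow> y \<in> X \<Longrightarrow> h + y \<in> X" for X
  proof -
    obtain y where "y \<in> X" using nonempty by blast
    then show ?thesis
      unfolding k_def using that by (intro card_le_of_stab_subset) auto
  qed
  \<comment> \<open>A coset of one stabilizer, cut by a set periodic under the other, is a union of
    cosets of the intersection; so a nonempty piece has at least \<open>k\<close> elements.\<close>
  have coset1: "k \<le> card X" if "X \<noteq> {}" "X = (+) x ` stab C1 \<inter> Y"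
      "\<And>h y. h \<in> stab C2 \<Longrightarrow> h + y \<in> Y \<longleftrightarrow> y \<in> Y" for X Y
    using that finS by (intro coset) (auto intro: step)
  have coset2: "k \<le> card X" if "X \<noteq> {}" "X = (+) x ` stab C2 \<inter> Y"
      "\<And>h y. h \<in> stab C1 \<Longrightarrow> h + y \<in> Y \<longleftrightarrow> y \<in> Y" for X Y
    using that finS by (intro coset) (auto intro: step)
  have ge1: "k \<le> p1" if "p1 > 0"
    using that unfolding p1_def by (intro coset1[where Y = "- C2"]) (auto simp: stabD card_gt_0_iff)
  have ge2: "k \<le> q1" if "q1 > 0"
    using that unfolding q1_def by (intro coset1[where Y = C2]) (auto simp: stabD card_gt_0_iff)
  have ge3: "k \<le> p2" if "p2 > 0"
    using that unfolding p2_def by (intro coset2[where Y = "- C1"]) (auto simp: stabD card_gt_0_iff)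
  have ge4: "k \<le> q2" if "q2 > 0"
    using that unfolding q2_def by (intro coset2[where Y = C1]) (auto simp: stabD card_gt_0_iff)
  note ge = ge1 ge2 ge3 ge4
  have 1: "p1 * q2 \<le> k * card (C1 - C2)"
    unfolding p1_def q2_def k_def
  proof (rule card_mult_le_stab_Int[OF finS, where x = x])
    fix u v assume "u \<in> ?D1 - C2" "v \<in> ?D2 \<inter> C1"
    then obtain g h where *: "g \<in> stab C1" "h \<in> stab C2" "u = x + g" "v = x + h" "u \<notin> C2" "v \<in> C1"
      by auto
    have "u + v - x = g + v" "u + v - x = h + u" using * by (simp_all add: algebra_simps)
    then show "u + v - x \<in> C1 - C2" using * stabD by (metis DiffI)
  qed (use fin in auto)
  have 2: "q1 * p2 \<le> k * card (C2 - C1)"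
    unfolding q1_def p2_def k_def
  proof (rule card_mult_le_stab_Int[OF finS, where x = x])
    fix u v assume "u \<in> ?D1 \<inter> C2" "v \<in> ?D2 - C1"
    then obtain g h where *: "g \<in> stab C1" "h \<in> stab C2" "u = x + g" "v = x + h" "u \<in> C2" "v \<notin> C1"
      by auto
    have "u + v - x = g + v" "u + v - x = h + u" using * by (simp_all add: algebra_simps)
    then show "u + v - x \<in> C2 - C1" using * stabD by (metis DiffI)
  qed (use fin in auto)
  have "x \<in> ?D1 - C2" "x \<in> ?D2 \<inter> C1"
    using x zero_in_stab by (auto simp: image_iff intro: bexI[of _ 0])
  then have pos: "p1 > 0" "q2 > 0"
    unfolding p1_def q2_def using finS by (auto simp: card_gt_0_iff)
  then have kle: "k \<le> p1" "k \<le> q2" using ge by auto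
  \<comment> \<open>If a piece is empty, its partner is a full coset and the first product bound
    suffices. For \<open>q1 = 0\<close> it bounds \<open>stab C1\<close>, and \<open>le\<close>
    passes this on to \<open>stab C2\<close>.\<close>
  consider "q1 = 0" | "p2 = 0" | "q1 > 0" "p2 > 0" by blast
  then show ?thesis
  proof cases
    case 1
    then have "k * card (stab C1) \<le> q2 * p1" using m kle by simp
    also have "\<dots> \<le> k * card (C1 - C2)" using \<open>p1 * q2 \<le> _\<close> by (simp add: mult.commute)
    finally show ?thesis using kpos le by simp
  next
    case 2
    then have "k * card (stab C2) \<le> p1 * q2" using m kle by simp
    also have "\<dots> \<le> k * card (C1 - C2)" by fact
    finally show ?thesis using kpos by simp
  next
    case 3
    show ?thesis
      unfolding m using grid_count_arith[OF kpos 1 2] ge 3 pos by simp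
  qed
qed

lemma stab_Int_subset_stab_Un: "stab C \<inter> stab D \<subseteq> stab (C \<union> D)"
  by (auto simp: stab_def)

text \<open>The union exceeds \<open>C2\<close> by \<open>C1 - C2\<close> and \<open>C1\<close> by
  \<open>C2 - C1\<close>. One of these gains covers the loss when the stabilizer drops to the
  intersection of both, which still stabilizes the union.\<close>

lemma card_union_stab:
  fixes C1 C2 :: "'a::ab_group_add set"
  assumes fin: "finite C1" "finite C2" and nsub: "\<not> C1 \<subseteq> C2" "\<not> C2 \<subseteq> C1"
    and n: "n \<le> card C1 + card (stab C1)" "n \<le> card C2 + card (stab C2)"
  shows "n \<le> card (C1 \<union> C2) + card (stab (C1 \<union> C2))"
proof -
  let ?k = "card (stab C1 \<inter> stab C2)"
  have ne: "C1 \<noteq> {}" "C2 \<noteq> {}" using nsub by auto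
  have k: "?k \<le> card (stab (C1 \<union> C2))"
    using fin ne by (intro card_mono finite_stab stab_Int_subset_stab_Un) auto
  have c: "card (C1 \<union> C2) = card C2 + card (C1 - C2)" "card (C1 \<union> C2) = card C1 + card (C2 - C1)"
    using fin card_Un_disjoint[of C2 "C1 - C2"] card_Un_disjoint[of C1 "C2 - C1"]
    by (auto simp: Un_commute)
  have "card (stab C2) \<le> card (C1 - C2) + ?k \<or> card (stab C1) \<le> card (C2 - C1) + ?k"
  proof (cases "card (stab C2) \<le> card (stab C1)")
    case True
    then show ?thesis using card_union_stab_aux[of C1 C2] fin ne nsub by auto
  next
    case False
    then show ?thesis using card_union_stab_aux[of C2 C1] fin ne nsub by (auto simp: Int_commute)
  qed
  then show ?thesis using k c n by linarith
qed

section \<open>The Dyson transform and Kneser's bound\<close>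

text \<open>Dyson transforms by \<open>e \<in> A\<close> shrink \<open>B\<close>; when none of them does, \<open>B \<subseteq> stab A\<close>.\<close>

lemma kneser_piece_zero:
  fixes A B :: "'a::ab_group_add set"
  assumes "finite A" "finite B" "0 \<in> A" "0 \<in> B"
  shows "\<exists>C. 0 \<in> C \<and> C \<subseteq> A + B \<and> card A + card B \<le> card C + card (stab C)"
  using assms
proof (induction "card B" arbitrary: A B rule: less_induct)
  case less
  show ?case
  proof (cases "\<exists>e\<in>A. \<exists>b\<in>B. b + e \<notin> A")
    case True
    then obtain e b where e: "e \<in> A" "b \<in> B" "b + e \<notin> A" by blast
    \<comment> \<open>The transform at \<open>e\<close> moves to \<open>A\<close>, shifted by
      \<open>e\<close>, those elements of \<open>B\<close> whose shift is not in \<open>A\<close>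
      yet. The total size is kept, and \<open>0\<close> stays in \<open>B'\<close> because
      \<open>e\<close> is in \<open>A\<close>.\<close>
    define A' where "A' = A \<union> (\<lambda>b. b + e) ` B"
    define B' where "B' = {b \<in> B. b + e \<in> A}"
    have fin: "finite A'" "finite B'" using less.prems by (auto simp: A'_def B'_def)
    have z: "0 \<in> A'" "0 \<in> B'" using less.prems e by (auto simp: A'_def B'_def)
    have "card B' < card B"
      using less.prems e by (intro psubset_card_mono) (auto simp: B'_def)
    then obtain C where C: "0 \<in> C" "C \<subseteq> A' + B'" "card A' + card B' \<le> card C + card (stab C)"
      using less.hyps fin z by blast
    have "A' + B' \<subseteq> A + B"
    proof
      fix y assume "y \<in> A' + B'"
      then obtain u v where uv: "u \<in> A'" "v \<in> B'" "y = u + v" by (auto elim: set_plus_elim)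
      show "y \<in> A + B"
      proof (cases "u \<in> A")
        case True
        then show ?thesis using uv by (auto simp: B'_def)
      next
        case False
        then obtain w where "w \<in> B" "u = w + e" using uv by (auto simp: A'_def)
        \<comment> \<open>The shift \<open>e\<close> passes from \<open>u\<close> to
          \<open>v\<close>, as \<open>v + e\<close> is in \<open>A\<close> for \<open>v\<close> in
          \<open>B'\<close>.\<close>
        then have "y = (v + e) + w" "v + e \<in> A" "w \<in> B" using uv by (auto simp: B'_def algebra_simps)
        then show ?thesis by blast
      qed
    qed
    moreover have "card A' + card B' = card A + card B"
    proof -
      have "card A' + card (A \<inter> (\<lambda>b. b + e) ` B) = card A + card ((\<lambda>b. b + e) ` B)"
        unfolding A'_def using less.prems by (intro card_Un_Int[symmetric]) auto
      moreover have "A \<inter> (\<lambda>b. b + e) ` B = (\<lambda>b. b + e) ` B'" by (auto simp: B'_def)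
      ultimately show ?thesis by (simp add: card_image inj_on_def)
    qed
    ultimately show ?thesis using C by (metis subset_trans)
  next
    case False
    \<comment> \<open>Here \<open>B\<close> translates \<open>A\<close> into itself, so
      \<open>A\<close> serves as \<open>C\<close>, its stabilizer paying for
      \<open>card B\<close>.\<close>
    have "B \<subseteq> stab A" using False less.prems by (auto intro: stabI)
    then have "card B \<le> card (stab A)"
      using less.prems by (intro card_mono finite_stab) auto
    moreover have "A \<subseteq> A + B" using less.prems by (metis add.commute set_zero_plus2)
    ultimately show ?thesis using less.prems by (intro exI[of _ A]) auto
  qed
qed

lemma stab_translate: "stab ((+) x ` C) = stab C" for C :: "'a::ab_group_add set"
proof -
  have *: "y \<in> (+) x ` C \<longleftrightarrow> y - x \<in> C" for y
    by (rule iffI) (auto intro!: image_eqI[of _ _ "y - x"])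
  have "(\<forall>c. h + c - x \<in> C \<longleftrightarrow> c - x \<in> C) \<longleftrightarrow> (\<forall>c. h + c \<in> C \<longleftrightarrow> c \<in> C)" (is "?L = ?R") for h
  proof
    assume L: ?L
    show ?R
    proof
      fix c show "h + c \<in> C \<longleftrightarrow> c \<in> C" using L[rule_format, of "c + x"] by (simp add: add.assoc[symmetric])
    qed
  next
    assume R: ?R
    show ?L
    proof
      fix c show "h + c - x \<in> C \<longleftrightarrow> c - x \<in> C" using R[rule_format, of "c - x"] by (simp add: add_diff_eq)
    qed
  qed
  then show ?thesis by (simp add: stab_def *)
qed

text \<open>Translating \<open>A\<close> and \<open>B\<close> by \<open>-a\<close> and
  \<open>-b\<close>, where \<open>c = a + b\<close>, moves \<open>c\<close> to \<open>0\<close>;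
  translating back changes neither size nor stabilizer.\<close>

lemma kneser_piece:
  fixes A B :: "'a::ab_group_add set"
  assumes "finite A" "finite B" "c \<in> A + B"
  shows "\<exists>C. c \<in> C \<and> C \<subseteq> A + B \<and> card A + card B \<le> card C + card (stab C)"
proof -
  obtain a b where ab: "a \<in> A" "b \<in> B" "c = a + b" using assms by (auto elim: set_plus_elim)
  have "\<exists>C. 0 \<in> C \<and> C \<subseteq> (+) (- a) ` A + (+) (- b) ` B \<and>
      card ((+) (- a) ` A) + card ((+) (- b) ` B) \<le> card C + card (stab C)"
    using ab assms by (intro kneser_piece_zero) (auto simp: image_iff intro: bexI[of _ a] bexI[of _ b])
  then obtain C where C: "0 \<in> C" "C \<subseteq> (+) (- a) ` A + (+) (- b) ` B"
      "card A + card B \<le> card C + card (stab C)"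
    unfolding card_coset by blast
  have "(+) c ` C \<subseteq> A + B"
  proof clarify
    fix y assume "y \<in> C"
    then obtain u v where "u \<in> A" "v \<in> B" "y = (- a + u) + (- b + v)"
      using C by (blast elim: set_plus_elim)
    then have "c + y = u + v" "u \<in> A" "v \<in> B" using ab by (auto simp: algebra_simps)
    then show "c + y \<in> A + B" by auto
  qed
  moreover have "c \<in> (+) c ` C" using C by (auto simp: image_iff intro: bexI[of _ 0])
  ultimately show ?thesis
    using C by (intro exI[of _ "(+) c ` C"]) (simp add: card_coset stab_translate)
qed

text \<open>A largest subset \<open>C\<close> of \<open>A + B\<close> satisfying the bound is
  everything: a missed point lies in some \<open>D\<close> that satisfies it too, and
  \<open>C \<union> D\<close> would then be a larger such set.\<close>

lemma kneser_weak:
  fixes A B :: "'a::ab_group_add set"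
  assumes fin: "finite A" "finite B" and ne: "A \<noteq> {}" "B \<noteq> {}"
  shows "card A + card B \<le> card (A + B) + card (stab (A + B))"
proof -
  let ?P = "\<lambda>C. C \<subseteq> A + B \<and> card A + card B \<le> card C + card (stab C)"
  have finAB: "finite (A + B)" using fin by (rule finite_set_plus)
  obtain c where "c \<in> A + B" using ne by blast
  then obtain C0 where "?P C0" using kneser_piece[OF fin] by blast
  moreover have "\<forall>C. ?P C \<longrightarrow> card C < Suc (card (A + B))"
    using card_mono[OF finAB] by (simp add: less_Suc_eq_le)
  ultimately obtain C where C: "?P C" and max: "\<And>D. ?P D \<Longrightarrow> card D \<le> card C"
    using Lattices_Big.ex_has_greatest_nat[of ?P C0 card "Suc (card (A + B))"] by blast
  have "C = A + B"
  proof (rule ccontr)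
    assume "C \<noteq> A + B"
    then obtain c where c: "c \<in> A + B" "c \<notin> C" using C by blast
    then obtain D where D: "c \<in> D" "?P D" using kneser_piece[OF fin c(1)] by blast
    have finCD: "finite C" "finite D" using C D finAB finite_subset by auto
    have "?P (C \<union> D)"
    proof (cases "C \<subseteq> D")
      case True
      then show ?thesis using D by (simp add: Un_absorb1)
    next
      case False
      then show ?thesis using C D c finCD card_union_stab[of C D] by blast
    qed
    moreover have "card C < card (C \<union> D)" using c D finCD by (intro psubset_card_mono) auto
    ultimately show False using max by (meson leD)
  qed
  then show ?thesis using C by simp
qed

lemma stab_add_left:
  assumes "finite A" "finite B"
  shows "stab A \<subseteq> stab (A + B)"
proof
  fix h assume h: "h \<in> stab A"
  show "h \<in> stab (A + B)"
  proof (rule stabI)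
    fix c assume "c \<in> A + B"
    then obtain x y where "x \<in> A" "y \<in> B" "c = x + y" by (rule set_plus_elim)
    then have "h + x \<in> A" "y \<in> B" "h + c = (h + x) + y" using stabD[OF h] by (simp_all add: add.assoc)
    then show "h + c \<in> A + B" by (metis set_plus_intro)
  qed (use assms in \<open>rule finite_set_plus\<close>)
qed

lemma stab_absorb: "C + stab C = C"
proof
  show "C + stab C \<subseteq> C"
    by (auto elim!: set_plus_elim) (metis add.commute stabD)
  show "C \<subseteq> C + stab C"
    using zero_in_stab by (metis add.commute set_zero_plus2)
qed

lemma stab_add_stab: "stab C + stab C = stab C"
proof
  show "stab C + stab C \<subseteq> stab C"
    by (auto elim!: set_plus_elim intro: add_in_stab)
  show "stab C \<subseteq> stab C + stab C"
    using zero_in_stab by (metis set_zero_plus2)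
qed

text \<open>Apply the weak form to \<open>A + H\<close> and \<open>B + H\<close>: since
  \<open>H\<close> is absorbed, their sum is again \<open>A + B\<close>, with the same
  stabilizer.\<close>

theorem kneser:
  fixes A B :: "'a::ab_group_add set"
  assumes fin: "finite A" "finite B" and ne: "A \<noteq> {}" "B \<noteq> {}"
  defines "H \<equiv> stab (A + B)"
  shows "card (A + H) + card (B + H) \<le> card (A + B) + card H"
proof -
  have "finite H" unfolding H_def using fin ne by (intro finite_stab finite_set_plus) blast+
  moreover have "H \<noteq> {}" using zero_in_stab H_def by blast
  moreover have "(A + H) + (B + H) = A + B"
  proof -
    have "(A + H) + (B + H) = (A + B) + (H + H)" by (simp add: ac_simps)
    also have "\<dots> = A + B" unfolding H_def by (simp add: stab_add_stab stab_absorb)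
    finally show ?thesis .
  qed
  ultimately show ?thesis
    using kneser_weak[of "A + H" "B + H"] fin ne finite_set_plus unfolding H_def
    by (metis (no_types, lifting) set_plus_intro empty_iff ex_in_conv)
qed

section \<open>Iterated sumsets\<close>

definition nfold :: "nat \<Rightarrow> 'a::comm_monoid_add set \<Rightarrow> 'a set" where
  "nfold h X = sum_list (replicate h X)"

lemma nfold_0 [simp]: "nfold 0 X = {0}"
  and nfold_Suc [simp]: "nfold (Suc h) X = X + nfold h X"
  by (simp_all add: nfold_def)

lemma nfold_add: "nfold (i + j) X = nfold i X + nfold j X"
  by (simp add: nfold_def replicate_add)

lemma finite_nfold: "finite X \<Longrightarrow> finite (nfold h X)"
  by (induction h) (auto intro: finite_set_plus)

lemma nfold_nonempty: "X \<noteq> {} \<Longrightarrow> nfold h X \<noteq> {}"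
  by (induction h) (auto simp: set_plus_def)

lemma mem_nfold_iff: "x \<in> nfold h X \<longleftrightarrow> (\<exists>xs. length xs = h \<and> set xs \<subseteq> X \<and> x = sum_list xs)"
proof (induction h arbitrary: x)
  case 0
  show ?case by auto
next
  case (Suc h)
  show ?case
  proof
    assume "x \<in> nfold (Suc h) X"
    then obtain y z where "y \<in> X" "z \<in> nfold h X" "x = y + z" by (auto elim: set_plus_elim)
    moreover from this obtain xs where "length xs = h" "set xs \<subseteq> X" "z = sum_list xs"
      using Suc.IH by blast
    ultimately show "\<exists>xs. length xs = Suc h \<and> set xs \<subseteq> X \<and> x = sum_list xs"
      by (intro exI[of _ "y # xs"]) simp
  next
    assume "\<exists>xs. length xs = Suc h \<and> set xs \<subseteq> X \<and> x = sum_list xs"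
    then obtain xs where xs: "length xs = Suc h" "set xs \<subseteq> X" "x = sum_list xs" by blast
    then obtain y ys where "xs = y # ys" by (cases xs) auto
    then show "x \<in> nfold (Suc h) X" using xs Suc.IH by auto
  qed
qed

lemma image_nfold:
  fixes \<phi> :: "'a::comm_monoid_add \<Rightarrow> 'b::comm_monoid_add"
  assumes "\<phi> 0 = 0" "\<And>x y. \<phi> (x + y) = \<phi> x + \<phi> y"
  shows "\<phi> ` nfold h X = nfold h (\<phi> ` X)"
proof (induction h)
  case (Suc h)
  have "\<phi> ` (X + nfold h X) = \<phi> ` X + \<phi> ` nfold h X"
    by (force simp: assms set_plus_def)
  then show ?case using Suc by simp
qed (simp add: assms)

lemma stab_nfold_mono:
  assumes "finite X" "i \<le> j"
  shows "stab (nfold i X) \<subseteq> stab (nfold j X)"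
proof -
  obtain m where "j = i + m" using assms(2) le_Suc_ex by blast
  then show ?thesis using stab_add_left[of "nfold i X" "nfold m X"] assms by (simp add: nfold_add finite_nfold)
qed

text \<open>The copies of \<open>H\<close> collapse to one. At least one summand is present because
  the empty sum \<open>{0}\<close> need not absorb \<open>H\<close>.\<close>

lemma nfold_plus_idem: "H + H = H \<Longrightarrow> nfold (Suc h) (A + H) = nfold (Suc h) A + H"
proof (induction h)
  case (Suc h)
  have "nfold (Suc (Suc h)) (A + H) = (A + H) + nfold (Suc h) (A + H)" by simp
  also have "\<dots> = A + H + (nfold (Suc h) A + H)" using Suc by simp
  also have "\<dots> = A + nfold (Suc h) A + (H + H)" by (simp only: ac_simps)
  finally show ?case using Suc by simp
qed simp

text \<open>Replacing \<open>A\<close> by \<open>A + H\<close> does not change the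
  \<open>h\<close>-fold sum, and the partial sums then have stabilizer exactly \<open>H\<close>.
  Each of the \<open>h - 1\<close> uses of Kneser's theorem therefore costs one
  \<open>card H\<close>.\<close>

lemma kneser_nfold:
  fixes A :: "'a::ab_group_add set"
  assumes fin: "finite A" and ne: "A \<noteq> {}" and "h \<ge> 1"
  defines "H \<equiv> stab (nfold h A)"
  shows "h * card (A + H) \<le> card (nfold h A) + (h - 1) * card H"
proof -
  let ?A = "A + H"
  have HH: "H + H = H" unfolding H_def by (rule stab_add_stab)
  obtain h' where h': "h = Suc h'" using \<open>h \<ge> 1\<close> by (cases h) auto
  have finH: "finite H" unfolding H_def using fin ne by (intro finite_stab finite_nfold nfold_nonempty)
  have finA: "finite ?A" using fin finH by (rule finite_set_plus)
  have neA: "?A \<noteq> {}" using ne zero_in_stab unfolding H_def by blast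
  have hA: "nfold h ?A = nfold h A"
    unfolding h' nfold_plus_idem[OF HH] using stab_absorb[of "nfold h A"] unfolding H_def h' .
  have "Suc j * card ?A \<le> card (nfold (Suc j) ?A) + j * card H" if "Suc j \<le> h" for j
    using that
  proof (induction j)
    case (Suc j)
    let ?X = "nfold (Suc j) ?A" and ?S = "stab (?A + nfold (Suc j) ?A)"
    have XH: "?X + H = ?X" unfolding nfold_plus_idem[OF HH] by (simp only: add.assoc HH)
    have AH: "?A + H = ?A" by (simp only: add.assoc HH)
    \<comment> \<open>Stabilizers grow with the number of summands, which gives this inclusion; the
      \<open>H\<close>-periodicity of \<open>?A\<close> gives the other.\<close>
    have "?S \<subseteq> H"
      using stab_nfold_mono[OF finA Suc.prems] hA unfolding H_def by simp
    moreover have "H \<subseteq> ?S"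
    proof
      fix x assume x: "x \<in> H"
      have "x \<in> stab ?A"
      proof (rule stabI[OF finA])
        fix c assume "c \<in> ?A"
        then have "c + x \<in> ?A + H" using x by (rule set_plus_intro)
        then show "x + c \<in> ?A" unfolding AH by (simp only: add.commute)
      qed
      then show "x \<in> ?S" using stab_add_left[OF finA finite_nfold[OF finA]] by blast
    qed
    ultimately have S: "?S = H" by blast
    have "card (?A + ?S) + card (?X + ?S) \<le> card (?A + ?X) + card ?S"
      using finA neA by (intro kneser finite_nfold nfold_nonempty)
    then have "card ?A + card ?X \<le> card (nfold (Suc (Suc j)) ?A) + card H"
      unfolding S AH XH by simp
    then show ?case using Suc by simp
  qed simp
  from this[of h'] have "h * card ?A \<le> card (nfold h ?A) + (h - 1) * card H"
    by (simp only: h' order_refl simp_thms diff_Suc_1)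
  then show ?thesis unfolding hA .
qed

text \<open>The translates \<open>X + Min Y\<close> and \<open>Max X + Y\<close> lie in the sumset
  and share at most \<open>Max X + Min Y\<close>.\<close>

lemma card_sumset_int:
  fixes X Y :: "int set"
  assumes "finite X" "finite Y" "X \<noteq> {}" "Y \<noteq> {}"
  shows "card X + card Y \<le> card (X + Y) + 1"
proof -
  let ?P = "(\<lambda>x. x + Min Y) ` X" and ?Q = "(+) (Max X) ` Y"
  have "?P \<inter> ?Q \<subseteq> {Max X + Min Y}"
  proof
    fix z assume "z \<in> ?P \<inter> ?Q"
    then obtain x y where "x \<in> X" "y \<in> Y" "z = x + Min Y" "z = Max X + y" by auto
    moreover from this have "x \<le> Max X" "Min Y \<le> y" using assms by auto
    ultimately show "z \<in> {Max X + Min Y}" by simp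
  qed
  then have "card (?P \<inter> ?Q) \<le> 1"
    using card_mono[of "{Max X + Min Y}" "?P \<inter> ?Q"] by simp
  moreover have "card ?P + card ?Q = card (?P \<union> ?Q) + card (?P \<inter> ?Q)"
    using assms by (intro card_Un_Int) auto
  moreover have "card (?P \<union> ?Q) \<le> card (X + Y)"
  proof (rule card_mono)
    show "finite (X + Y)" using assms(1,2) by (rule finite_set_plus)
    show "?P \<union> ?Q \<subseteq> X + Y"
      using Max_in[OF assms(1,3)] Min_in[OF assms(2,4)] by auto
  qed
  moreover have "card ?P = card X" "card ?Q = card Y" by (simp_all add: card_image inj_on_def)
  ultimately show ?thesis by linarith
qed

lemma card_sum_list_int:
  fixes E :: "'a \<Rightarrow> int set"
  assumes "\<And>b. b \<in> set bs \<Longrightarrow> finite (E b) \<and> E b \<noteq> {}"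
  shows "finite (sum_list (map E bs)) \<and> sum_list (map E bs) \<noteq> {} \<and>
    (\<Sum>b\<leftarrow>bs. card (E b)) + 1 \<le> card (sum_list (map E bs)) + length bs"
  using assms
proof (induction bs)
  case (Cons b bs)
  let ?S = "sum_list (map E bs)"
  have IH: "finite ?S" "?S \<noteq> {}" "(\<Sum>b\<leftarrow>bs. card (E b)) + 1 \<le> card ?S + length bs"
    using Cons by auto
  have b: "finite (E b)" "E b \<noteq> {}" using Cons.prems by auto
  have "finite (E b + ?S)" using b(1) IH(1) by (rule finite_set_plus)
  moreover have "E b + ?S \<noteq> {}" using IH b by (auto simp: set_plus_def)
  ultimately show ?case using IH card_sumset_int[OF b(1) IH(1) b(2) IH(2)] by simp
qed simp

section \<open>Lev's inequality\<close>

text \<open>By division with remainder, the least positive element \<open>d\<close> of the subgroup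
  \<open>D\<close> divides every element of \<open>B\<close>, hence \<open>Gcd B\<close>.\<close>

lemma subgroup_int_gcd_1:
  fixes D B :: "int set"
  assumes D0: "0 \<in> D" and Dadd: "\<And>x y. x \<in> D \<Longrightarrow> y \<in> D \<Longrightarrow> x + y \<in> D"
    and Ddiff: "\<And>x y. x \<in> D \<Longrightarrow> y \<in> D \<Longrightarrow> x - y \<in> D"
    and BD: "B \<subseteq> D" and gcd: "Gcd B = 1"
  shows "1 \<in> D"
proof -
  have "\<not> B \<subseteq> {0}" using gcd by (metis Gcd_0_iff zero_neq_one)
  then obtain b where b: "b \<in> D" "b \<noteq> 0" using BD by blast
  have "- b \<in> D" using Ddiff[OF D0 b(1)] by simp
  then have ex: "\<exists>n. n > 0 \<and> int n \<in> D"
    using b by (intro exI[of _ "nat \<bar>b\<bar>"]) (simp add: abs_if)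
  define d where "d = (LEAST n. n > 0 \<and> int n \<in> D)"
  have d: "d > 0" "int d \<in> D" using LeastI_ex[OF ex] unfolding d_def by auto
  have nat_mult: "int n * int d \<in> D" for n
  proof (induction n)
    case (Suc n)
    then show ?case using Dadd[OF d(2) Suc] by (simp add: algebra_simps)
  qed (simp add: D0)
  have mult: "z * int d \<in> D" for z
  proof (cases "z \<ge> 0")
    case True
    then show ?thesis using nat_mult[of "nat z"] by simp
  next
    case False
    then show ?thesis using Ddiff[OF D0 nat_mult[of "nat (- z)"]] by simp
  qed
  have "int d dvd x" if "x \<in> B" for x
  proof -
    have "x - (x div int d) * int d \<in> D" using that BD by (intro Ddiff mult) auto
    then have r: "x mod int d \<in> D" by (simp add: minus_div_mult_eq_mod)
    have "x mod int d < int d" "x mod int d \<ge> 0" using d by simp_all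
    then have "nat (x mod int d) < d" by simp
    then have "\<not> (nat (x mod int d) > 0 \<and> int (nat (x mod int d)) \<in> D)"
      unfolding d_def by (rule not_less_Least)
    then have "x mod int d = 0" using r \<open>x mod int d \<ge> 0\<close> by simp
    then show ?thesis by (simp add: dvd_eq_mod_eq_0)
  qed
  then have "int d dvd Gcd B" by (rule Gcd_greatest)
  then have "d = 1" using gcd by simp
  then show ?thesis using d by simp
qed

text \<open>\<open>\<phi>\<close> plays the role of reduction modulo \<open>l\<close>. Its target is
  an arbitrary group type because the quotient depends on the value \<open>l\<close>.\<close>

lemma lev_hom:
  fixes \<phi> :: "int \<Rightarrow> 'g::ab_group_add" and B :: "int set"
  assumes hom: "\<And>x y. \<phi> (x + y) = \<phi> x + \<phi> y"
    and ker: "\<And>x y. \<phi> x = \<phi> y \<longleftrightarrow> l dvd x - y"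
    and B: "B \<subseteq> {0..l}" "0 \<in> B" "l \<in> B" "l > 0"
    and gcd: "Gcd B = 1" and "h \<ge> 1" and cardB: "card B = Suc k"
  shows "min (nat l) (h * (k - 1) + 1) \<le> card (nfold h B - nfold (h - 1) B)"
proof -
  have \<phi>0: "\<phi> 0 = 0" using hom[of 0 0] by simp
  have \<phi>diff: "\<phi> (x - y) = \<phi> x - \<phi> y" for x y
    using hom[of "x - y" y] by (simp add: algebra_simps)
  obtain h' where h': "h = Suc h'" using \<open>h \<ge> 1\<close> by (cases h) auto
  have inj: "inj_on \<phi> {0..<l}"
  proof (rule inj_onI)
    fix x y assume xy: "x \<in> {0..<l}" "y \<in> {0..<l}" "\<phi> x = \<phi> y"
    then have "0 \<le> x" "x < l" "0 \<le> y" "y < l" by auto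
    moreover have "x mod l = y mod l" using ker xy(3) by (simp only: mod_eq_dvd_iff)
    ultimately show "x = y" by simp
  qed
  have finB: "finite B" using B(1) finite_subset by blast
  define A where "A = \<phi> ` B"
  have finA: "finite A" and neA: "A \<noteq> {}"
    unfolding A_def using finB B by auto
  have cardA: "card A = k"
  proof -
    have "\<phi> l = \<phi> 0" using ker by simp
    then have "A = \<phi> ` (B - {l})"
      unfolding A_def using B by (auto simp: image_iff)
    moreover have "B - {l} \<subseteq> {0..<l}" using B(1) by force
    then have "inj_on \<phi> (B - {l})" by (rule inj_on_subset[OF inj])
    ultimately show ?thesis using cardB finB B by (simp add: card_image)
  qed
  define G where "G = nfold h A"
  define H where "H = stab G"
  define N where "N = nfold h B - nfold (h - 1) B"
  have G: "G = \<phi> ` nfold h B" unfolding G_def A_def using image_nfold[OF \<phi>0 hom] by simp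
  have finN: "finite N" unfolding N_def using finB finite_nfold by blast
  have finG: "finite G" and neG: "G \<noteq> {}"
    unfolding G_def using finA neA by (auto simp: finite_nfold nfold_nonempty)
  have finH: "finite H" unfolding H_def using finG neG by (rule finite_stab)
  have "\<exists>t. t \<in> N \<and> \<phi> t = g" if "g \<in> G" for g
  proof -
    let ?T = "{t \<in> nfold h B. \<phi> t = g}"
    have T: "finite ?T" "?T \<noteq> {}" using finite_nfold[OF finB] that G by auto
    define t where "t = Max ?T"
    have t: "t \<in> ?T" using Max_in[OF T] unfolding t_def .
    have "t \<notin> nfold (h - 1) B"
    proof
      assume "t \<in> nfold (h - 1) B"
      then have "l + t \<in> nfold h B" using B h' by auto
      moreover have "\<phi> (l + t) = g" using t ker[of "l + t" t] by simp
      ultimately have "l + t \<le> t" unfolding t_def using T by (intro Max_ge) auto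
      then show False using B by simp
    qed
    then show ?thesis using t unfolding N_def by blast
  qed
  then obtain f where f: "\<And>g. g \<in> G \<Longrightarrow> f g \<in> N" "\<And>g. g \<in> G \<Longrightarrow> \<phi> (f g) = g" by metis
  \<comment> \<open>\<open>f\<close> picks one new sum in each class of \<open>G\<close>; hence
    \<open>card G \<le> card N\<close>.\<close>
  have injf: "inj_on f G" using f(2) by (metis inj_onI)
  show ?thesis
  proof (cases "G \<subseteq> nfold (h - 1) A + H")
    \<comment> \<open>Here \<open>A\<close> stabilizes \<open>G\<close>, so the preimage
      \<open>D\<close> of \<open>H\<close> is a subgroup containing \<open>B\<close>, hence
      containing 1. Then \<open>H\<close>, and with it \<open>G\<close>, has at least
      \<open>l\<close> elements.\<close>
    case True
    have "a \<in> H" if "a \<in> A" for a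
      unfolding H_def
    proof (rule stabI[OF finG])
      fix g assume "g \<in> G"
      then obtain x y where xy: "x \<in> nfold (h - 1) A" "y \<in> H" "g = x + y"
        using True by (blast elim: set_plus_elim)
      then have "a + x \<in> G" unfolding G_def using that h' by auto
      then have "y + (a + x) \<in> G" using xy stabD unfolding H_def by blast
      then show "a + g \<in> G" using xy by (simp add: ac_simps)
    qed
    then have BH: "\<phi> b \<in> H" if "b \<in> B" for b using that unfolding A_def by blast
    define D where "D = {x. \<phi> x \<in> H}"
    have Dadd: "x + y \<in> D" if "x \<in> D" "y \<in> D" for x y
      using that add_in_stab unfolding D_def H_def by (simp add: hom)
    have Ddiff: "x - y \<in> D" if "x \<in> D" "y \<in> D" for x y
      using that diff_in_stab unfolding D_def H_def by (simp add: \<phi>diff)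
    have D0: "0 \<in> D" unfolding D_def H_def by (simp add: \<phi>0 zero_in_stab)
    have D1: "1 \<in> D"
      using subgroup_int_gcd_1[OF D0 Dadd Ddiff _ gcd] BH unfolding D_def by blast
    have Dall: "int n \<in> D" for n
      by (induction n) (use D0 D1 Dadd in \<open>auto simp: add.commute\<close>)
    have "\<phi> ` {0..<l} \<subseteq> H"
    proof clarify
      fix x assume "x \<in> {0..<l}"
      then show "\<phi> x \<in> H" using Dall[of "nat x"] unfolding D_def by simp
    qed
    then have "nat l \<le> card H" using inj finH card_inj_on_le[of \<phi> "{0..<l}" H] by simp
    also have "\<dots> \<le> card G"
    proof -
      obtain g where "g \<in> G" using neG by blast
      then show ?thesis using finG stabD unfolding H_def by (intro card_le_of_stab_subset) auto
    qed
    also have "\<dots> \<le> card N" using f(1) injf finN by (intro card_inj_on_le[of f]) auto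
    finally show ?thesis unfolding N_def by simp
  next
    case False
    then obtain c where c: "c \<in> G" "c \<notin> nfold (h - 1) A + H" by blast
    then obtain s where s: "s \<in> nfold h B" "c = \<phi> s" using G by blast
    then obtain bs where bs: "length bs = h" "set bs \<subseteq> B" "s = sum_list bs"
      by (auto simp: mem_nfold_iff)
    \<comment> \<open>\<open>E b\<close> collects the elements of \<open>B\<close> congruent to
      \<open>b\<close> modulo \<open>H\<close>. Varying each term of \<open>s\<close> within its
      class yields \<open>M\<close>, whose image stays in \<open>c + H\<close> and so avoids
      \<open>nfold (h - 1) A\<close>.\<close>
    define E where "E b = {x \<in> B. \<phi> x - \<phi> b \<in> H}" for b
    define M where "M = sum_list (map E bs)"
    have E: "finite (E b) \<and> E b \<noteq> {}" if "b \<in> B" for b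
      using that finB zero_in_stab[of G] unfolding E_def H_def
      by (auto intro!: exI[of _ b])
    have M: "(\<Sum>b\<leftarrow>bs. card (E b)) + 1 \<le> card M + h"
      using card_sum_list_int[of bs E] E bs unfolding M_def by auto
    have "sum_list (map E cs) \<subseteq> nfold (length cs) B \<and>
        (\<forall>t\<in>sum_list (map E cs). \<phi> t - \<phi> (sum_list cs) \<in> H)" for cs
    proof (induction cs)
      case Nil
      show ?case by (simp add: \<phi>0 H_def zero_in_stab)
    next
      case (Cons d cs)
      have "E d \<subseteq> B" unfolding E_def by blast
      then have "sum_list (map E (d # cs)) \<subseteq> nfold (length (d # cs)) B"
        using Cons set_plus_mono2[of "E d" B "sum_list (map E cs)" "nfold (length cs) B"] by simp
      moreover have "\<phi> t - \<phi> (sum_list (d # cs)) \<in> H" if t: "t \<in> sum_list (map E (d # cs))" for t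
      proof -
        from t obtain u v where uv: "u \<in> E d" "v \<in> sum_list (map E cs)" "t = u + v"
          by (auto elim: set_plus_elim)
        then have "(\<phi> u - \<phi> d) + (\<phi> v - \<phi> (sum_list cs)) \<in> H"
          using Cons unfolding E_def H_def by (intro add_in_stab) auto
        then show ?thesis using uv by (simp add: hom algebra_simps)
      qed
      ultimately show ?case by blast
    qed
    then have M_sub: "M \<subseteq> nfold h B" and M_H: "\<And>t. t \<in> M \<Longrightarrow> \<phi> t - c \<in> H"
      using bs s unfolding M_def by auto
    have MN: "M \<subseteq> N"
    proof
      fix t assume t: "t \<in> M"
      have "t \<notin> nfold (h - 1) B"
      proof
        assume "t \<in> nfold (h - 1) B"
        then have "\<phi> t \<in> nfold (h - 1) A" unfolding A_def image_nfold[OF \<phi>0 hom, symmetric] by blast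
        moreover have "c - \<phi> t \<in> H" using M_H[OF t] minus_in_stab unfolding H_def by fastforce
        ultimately have "\<phi> t + (c - \<phi> t) \<in> nfold (h - 1) A + H" by blast
        then show False using c by simp
      qed
      then show "t \<in> N" using t M_sub unfolding N_def by blast
    qed
    let ?K = "(+) c ` H"
    have K: "?K \<subseteq> G" using c stabD unfolding H_def by (auto simp: add.commute)
    \<comment> \<open>\<open>A\<close> and the coset of \<open>\<phi> b\<close> both lie in
      \<open>A + H\<close>, so \<open>A\<close> misses at most \<open>card (A + H) - card A\<close>
      points of the coset; the others come from \<open>E b\<close>.\<close>
    have cE: "card A + card H \<le> card (E b) + card (A + H)" if b: "b \<in> B" for b
    proof -
      let ?C = "(+) (\<phi> b) ` H"
      have "A \<inter> ?C \<subseteq> \<phi> ` E b" unfolding A_def E_def by auto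
      then have "card (A \<inter> ?C) \<le> card (E b)"
        using E[OF b] by (meson card_image_le card_mono finite_imageI le_trans)
      moreover have "card (A \<union> ?C) \<le> card (A + H)"
      proof (rule card_mono)
        show "finite (A + H)" using finA finH by (rule finite_set_plus)
        have "A \<subseteq> A + H" using zero_in_stab unfolding H_def by (metis add.commute set_zero_plus2)
        then show "A \<union> ?C \<subseteq> A + H" using b unfolding A_def by auto
      qed
      moreover have "card A + card ?C = card (A \<union> ?C) + card (A \<inter> ?C)"
        using finA finH by (intro card_Un_Int) auto
      ultimately show ?thesis by (simp add: card_coset)
    qed
    have "length cs * (card A + card H) \<le> (\<Sum>b\<leftarrow>cs. card (E b)) + length cs * card (A + H)"
      if "set cs \<subseteq> B" for cs
      using that
    proof (induction cs)
      case (Cons d cs)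
      then show ?case using cE[of d] by simp
    qed simp
    from this[of bs] have sumE: "h * card A + h * card H \<le> (\<Sum>b\<leftarrow>bs. card (E b)) + h * card (A + H)"
      using bs by (simp add: algebra_simps)
    \<comment> \<open>Outside the coset \<open>c + H\<close> one element per class is kept; over the
      coset all of \<open>M\<close> is used.\<close>
    have "f ` (G - ?K) \<inter> M = {}"
    proof (rule ccontr)
      assume "f ` (G - ?K) \<inter> M \<noteq> {}"
      then obtain g where g: "g \<in> G" "g \<notin> ?K" "f g \<in> M" by blast
      then have "g - c \<in> H" using M_H[of "f g"] f(2) by simp
      then have "c + (g - c) \<in> ?K" by blast
      then show False using g by simp
    qed
    then have "card (f ` (G - ?K)) + card M = card (f ` (G - ?K) \<union> M)"
      using finG finN MN finite_subset by (intro card_Un_disjoint[symmetric]) auto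
    also have "\<dots> \<le> card N" using MN f(1) finN by (intro card_mono) auto
    finally have "card (f ` (G - ?K)) + card M \<le> card N" .
    moreover have "card (f ` (G - ?K)) = card (G - ?K)"
      using injf by (intro card_image) (auto intro: inj_on_subset)
    moreover have "card (G - ?K) + card H = card G"
      using K finH finG by (simp add: card_Diff_subset card_coset)
        (metis card_coset card_mono le_add_diff_inverse2)
    ultimately have 1: "card G + card M \<le> card N + card H" by linarith
    have 2: "h * card (A + H) \<le> card G + (h - 1) * card H"
      unfolding G_def H_def using kneser_nfold[OF finA neA \<open>h \<ge> 1\<close>] by simp
    have 3: "(h - 1) * card H + card H = h * card H" using h' by simp
    \<comment> \<open>The terms in \<open>card H\<close> and \<open>card (A + H)\<close> cancel
      exactly: the deficits of the \<open>E b\<close> are balanced by Kneser's bound.\<close>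
    have "h * k + 1 \<le> card N + h" using 1 2 3 M sumE[unfolded cardA] by linarith
    moreover have "h * k = h * (k - 1) + h" if "k \<ge> 1"
      using that by (cases k) auto
    moreover have "k \<ge> 1" using cardA finA neA by (simp add: card_gt_0_iff Suc_le_eq flip: cardA)
    ultimately have "h * (k - 1) + 1 \<le> card N" by linarith
    then show ?thesis unfolding N_def by simp
  qed
qed

section \<open>The rationals modulo the integers\<close>

text \<open>The group \<open>\<rat>/\<int>\<close>, represented by fractional parts, is a single type that contains every
  \<open>\<int>/l\<close>.\<close>

typedef qz = "{x::rat. 0 \<le> x \<and> x < 1}"
  by (intro exI[of _ 0]) simp

definition qz_of :: "rat \<Rightarrow> qz" where
  "qz_of x = Abs_qz (frac x)"

lemma Rep_qz_of: "Rep_qz (qz_of x) = frac x"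
  unfolding qz_of_def by (rule Abs_qz_inverse) (simp add: frac_lt_1)

lemma qz_of_Rep: "qz_of (Rep_qz q) = q"
proof -
  have "frac (Rep_qz q) = Rep_qz q" using Rep_qz[of q] by (simp add: frac_eq)
  then show ?thesis by (simp add: qz_of_def Rep_qz_inverse)
qed

lemma qz_of_cases: obtains x where "q = qz_of x"
  using qz_of_Rep by metis

lemma qz_of_eq_iff: "qz_of x = qz_of y \<longleftrightarrow> x - y \<in> \<int>"
proof -
  have "qz_of x = qz_of y \<longleftrightarrow> frac x = frac y"
    by (metis Rep_qz_of qz_of_def)
  also have "\<dots> \<longleftrightarrow> x - y \<in> \<int>"
  proof
    assume "frac x = frac y"
    then have "x - y = of_int (\<lfloor>x\<rfloor> - \<lfloor>y\<rfloor>)" by (simp add: frac_def algebra_simps)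
    then show "x - y \<in> \<int>" by (metis Ints_of_int)
  next
    assume "x - y \<in> \<int>"
    then show "frac x = frac y" using frac_add_int_right[of "x - y" y] by simp
  qed
  finally show ?thesis .
qed

instantiation qz :: ab_group_add
begin

definition zero_qz where "0 = qz_of 0"
definition plus_qz where "p + q = qz_of (Rep_qz p + Rep_qz q)"
definition uminus_qz where "- p = qz_of (- Rep_qz p)"
definition minus_qz where "p - q = qz_of (Rep_qz p - Rep_qz q)"

lemma qz_of_add: "qz_of x + qz_of y = qz_of (x + y)"
  unfolding plus_qz_def Rep_qz_of qz_of_eq_iff by (simp add: frac_def algebra_simps)

lemma qz_of_minus: "- qz_of x = qz_of (- x)"
  unfolding uminus_qz_def Rep_qz_of qz_of_eq_iff by (simp add: frac_def)

lemma qz_of_diff: "qz_of x - qz_of y = qz_of (x - y)"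
  unfolding minus_qz_def Rep_qz_of qz_of_eq_iff by (simp add: frac_def algebra_simps)

instance
proof
  fix p q s :: qz
  obtain x y z where [simp]: "p = qz_of x" "q = qz_of y" "s = qz_of z"
    by (metis qz_of_cases)
  show "p + q + s = p + (q + s)" by (simp add: qz_of_add add.assoc)
  show "p + q = q + p" by (simp add: qz_of_add add.commute)
  show "0 + p = p" by (simp add: zero_qz_def qz_of_add)
  show "- p + p = 0" by (simp add: zero_qz_def qz_of_add qz_of_minus)
  show "p - q = p + - q" by (simp add: qz_of_add qz_of_minus qz_of_diff)
qed

end

lemma qz_of_divide_eq_iff:
  assumes "l > 0"
  shows "qz_of (of_int x / of_int l) = qz_of (of_int y / of_int l) \<longleftrightarrow> l dvd x - y"
proof -
  have "of_int x / of_int l - of_int y / of_int l = (of_int (x - y) / of_int l :: rat)"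
    by (simp add: diff_divide_distrib)
  moreover have "(of_int z / of_int l :: rat) \<in> \<int> \<longleftrightarrow> l dvd z" for z
  proof
    assume "(of_int z / of_int l :: rat) \<in> \<int>"
    then obtain m where "(of_int z / of_int l :: rat) = of_int m" by (auto elim: Ints_cases)
    then have "(of_int z :: rat) = of_int (l * m)" using assms by (simp add: field_simps)
    then show "l dvd z" by (metis dvd_triv_left of_int_eq_iff)
  next
    assume "l dvd z"
    then obtain m where "z = l * m" by (elim dvdE)
    then show "(of_int z / of_int l :: rat) \<in> \<int>" using assms by simp
  qed
  ultimately show ?thesis unfolding qz_of_eq_iff by (simp only:)
qed

text \<open>Take division by \<open>l\<close> modulo 1 for \<open>\<phi>\<close>. As
  \<open>0\<close> is in \<open>B\<close>, the sumsets are nested, so the new elements counted by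
  \<open>lev_hom\<close> are the difference of the sizes.\<close>

lemma lev:
  fixes B :: "int set"
  assumes "B \<subseteq> {0..l}" "0 \<in> B" "l \<in> B" "l > 0" "Gcd B = 1" "h \<ge> 1" "card B = Suc k"
  shows "card (nfold (h - 1) B) + min (nat l) (h * (k - 1) + 1) \<le> card (nfold h B)"
proof -
  let ?\<phi> = "\<lambda>x. qz_of (of_int x / of_int l)"
  have gain: "min (nat l) (h * (k - 1) + 1) \<le> card (nfold h B - nfold (h - 1) B)"
  proof (rule lev_hom[where \<phi> = ?\<phi>])
    show "?\<phi> (x + y) = ?\<phi> x + ?\<phi> y" for x y
      by (simp add: qz_of_add add_divide_distrib)
    show "?\<phi> x = ?\<phi> y \<longleftrightarrow> l dvd x - y" for x y
      using \<open>l > 0\<close> by (rule qz_of_divide_eq_iff)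
  qed fact+
  have "finite B" using assms(1) finite_subset by blast
  then have fin: "finite (nfold i B)" for i by (rule finite_nfold)
  obtain h' where "h = Suc h'" using \<open>h \<ge> 1\<close> by (cases h) auto
  then have sub: "nfold (h - 1) B \<subseteq> nfold h B" using set_zero_plus2[OF \<open>0 \<in> B\<close>] by simp
  then have "card (nfold h B) = card (nfold (h - 1) B) + card (nfold h B - nfold (h - 1) B)"
    using fin card_mono[OF fin sub] by (simp add: card_Diff_subset)
  then show ?thesis using gain by simp
qed

section \<open>Subsequence sums\<close>

lemma sumset_fold_eq_nfold: "sumset_fold h X = nfold h X"
  by (auto simp: sumset_fold_def mem_nfold_iff)

text \<open>Scan from the left: the head is skipped as long as the tail supplies enough copies of
  it, and kept otherwise.\<close>

lemma ex_subseq_with_counts: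
  assumes "\<And>x. m x \<le> count_list xs x"
  shows "\<exists>ys. subseq ys xs \<and> (\<forall>x. count_list ys x = m x)"
  using assms
proof (induction xs arbitrary: m)
  case Nil
  then show ?case by (intro exI[of _ "[]"]) simp
next
  case (Cons y xs)
  show ?case
  proof (cases "m y \<le> count_list xs y")
    case True
    have "m x \<le> count_list xs x" for x
      using True Cons.prems[of x] by (cases "x = y") auto
    then show ?thesis using Cons.IH by blast
  next
    case False
    then have my: "m y = Suc (count_list xs y)" using Cons.prems[of y] by simp
    have "(m(y := m y - 1)) x \<le> count_list xs x" for x
      using my Cons.prems[of x] by (cases "x = y") auto
    then obtain ys where "subseq ys xs" "\<forall>x. count_list ys x = (m(y := m y - 1)) x"
      using Cons.IH by blast
    then show ?thesis using my by (intro exI[of _ "y # ys"]) auto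
  qed
qed

lemma sum_list_eq_sum_count:
  fixes xs :: "int list"
  assumes "finite S" "set xs \<subseteq> S"
  shows "sum_list xs = (\<Sum>x\<in>S. int (count_list xs x) * x)"
  using assms(2)
proof (induction xs)
  case (Cons y xs)
  have "(\<Sum>x\<in>S. int (count_list (y # xs) x) * x) =
      (\<Sum>x\<in>S. int (count_list xs x) * x + (if x = y then x else 0))"
    by (intro sum.cong) (auto simp: algebra_simps)
  also have "\<dots> = sum_list xs + y"
    using Cons assms(1) by (simp add: sum.distrib)
  finally show ?case by simp
qed simp

text \<open>Coefficient vectors make the sums independent of the order of the list. The zero vector
  is allowed, so the empty sum \<open>0\<close> always belongs.\<close>

definition box_sums :: "nat \<Rightarrow> (nat \<Rightarrow> int) \<Rightarrow> (nat \<Rightarrow> nat) \<Rightarrow> int set" where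
  "box_sums k a r = {\<Sum>i=1..k. int (c i) * a i | c. \<forall>i\<in>{1..k}. c i \<le> r i}"

lemma box_sumsI:
  assumes "\<And>i. i \<in> {1..k} \<Longrightarrow> c i \<le> r i" "s = (\<Sum>i=1..k. int (c i) * a i)"
  shows "s \<in> box_sums k a r"
  unfolding box_sums_def using assms by (intro CollectI exI[of _ c] conjI) auto

lemma finite_subseq_sums: "finite (subseq_sums xs)"
proof -
  have "subseq_sums xs \<subseteq> sum_list ` set (subseqs xs)"
    by (auto simp: subseq_sums_def)
  then show ?thesis by (rule finite_subset) simp
qed

lemma box_sums_subset:
  assumes "seq_with_mult xs k a r"
  shows "box_sums k a r \<subseteq> insert 0 (subseq_sums xs)"
proof
  fix s assume "s \<in> box_sums k a r"
  then obtain c where c: "\<forall>i\<in>{1..k}. c i \<le> r i" "s = (\<Sum>i=1..k. int (c i) * a i)"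
    unfolding box_sums_def by blast
  have inj: "inj_on a {1..k}" and set: "set xs = a ` {1..k}"
    and cnt: "\<forall>i\<in>{1..k}. count_list xs (a i) = r i"
    using assms unfolding seq_with_mult_def by auto
  \<comment> \<open>\<open>m\<close> carries \<open>c\<close> from indices to values; the default 0
    keeps it below the counts at values outside the list.\<close>
  define m where "m x = (if x \<in> a ` {1..k} then c (the_inv_into {1..k} a x) else 0)" for x
  have m: "m (a i) = c i" if "i \<in> {1..k}" for i
    using that the_inv_into_f_f[OF inj that] unfolding m_def by simp
  have "m x \<le> count_list xs x" for x
  proof (cases "x \<in> a ` {1..k}")
    case True
    then obtain i where "i \<in> {1..k}" "x = a i" by blast
    then show ?thesis using m c cnt by simp
  qed (simp add: m_def)
  then obtain ys where ys: "subseq ys xs" "\<forall>x. count_list ys x = m x"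
    using ex_subseq_with_counts by blast
  have "set ys \<subseteq> a ` {1..k}"
    using list_emb_set[OF ys(1)] set by blast
  then have "sum_list ys = (\<Sum>x\<in>a ` {1..k}. int (count_list ys x) * x)"
    by (intro sum_list_eq_sum_count) auto
  also have "\<dots> = (\<Sum>i=1..k. int (m (a i)) * a i)"
    using ys(2) unfolding sum.reindex[OF inj] by simp
  also have "\<dots> = s" unfolding c(2) by (intro sum.cong) (simp_all add: m)
  finally have "sum_list ys = s" .
  then show "s \<in> insert 0 (subseq_sums xs)"
    using ys(1) unfolding subseq_sums_def by (cases "ys = []") auto
qed

text \<open>A sum of \<open>h\<close> terms uses each \<open>a i\<close> at most \<open>h\<close>
  times; terms \<open>0\<close> only pad the length, and \<open>nz\<close> separates them from the
  \<open>a i\<close>.\<close>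

lemma nfold_subset_box_sums:
  assumes inj: "inj_on a {1..k}" and nz: "\<And>i. i \<in> {1..k} \<Longrightarrow> a i \<noteq> 0"
    and r: "\<And>i. i \<in> {1..k} \<Longrightarrow> h \<le> r i"
  shows "nfold h (a ` {1..k} \<union> {0}) \<subseteq> box_sums k a r"
proof
  fix s assume "s \<in> nfold h (a ` {1..k} \<union> {0})"
  then obtain xs where xs: "length xs = h" "set xs \<subseteq> insert 0 (a ` {1..k})" "s = sum_list xs"
    by (auto simp: mem_nfold_iff)
  have "s = (\<Sum>x\<in>insert 0 (a ` {1..k}). int (count_list xs x) * x)"
    unfolding xs(3) by (rule sum_list_eq_sum_count) (use xs in auto)
  also have "\<dots> = (\<Sum>x\<in>a ` {1..k}. int (count_list xs x) * x)"
    using nz by (subst sum.insert) auto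
  also have "\<dots> = (\<Sum>i=1..k. int (count_list xs (a i)) * a i)"
    unfolding sum.reindex[OF inj] by simp
  finally have s: "s = (\<Sum>i=1..k. int (count_list xs (a i)) * a i)" .
  show "s \<in> box_sums k a r"
  proof (rule box_sumsI[OF _ s])
    fix i assume "i \<in> {1..k}"
    then show "count_list xs (a i) \<le> r i" using count_le_length[of xs "a i"] r[of i] xs(1) by simp
  qed
qed

section \<open>Counting sums on the way to the full sum\<close>

lemma nfold_le:
  fixes X :: "int set"
  assumes "\<And>x. x \<in> X \<Longrightarrow> x \<le> m"
  shows "s \<in> nfold h X \<Longrightarrow> s \<le> int h * m"
proof (induction h arbitrary: s)
  case (Suc h)
  then obtain x y where "x \<in> X" "y \<in> nfold h X" "s = x + y" by (auto elim: set_plus_elim)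
  then show ?case using assms[of x] Suc.IH[of y] by (simp add: algebra_simps)
qed simp

text \<open>The level at which the copies above index \<open>j\<close> are used up and those of
  \<open>a j\<close> come next; it runs from \<open>0\<close> at \<open>j = k\<close> to the full
  sum at \<open>j = 0\<close>.\<close>

definition top_sum :: "nat \<Rightarrow> (nat \<Rightarrow> int) \<Rightarrow> (nat \<Rightarrow> nat) \<Rightarrow> nat \<Rightarrow> int" where
  "top_sum k a r j = (\<Sum>i=Suc j..k. int (r i) * a i)"

lemma top_sum_add_in_box_sums:
  assumes "i \<in> {1..j}" "j \<le> k" "t < r j" and r: "\<And>i. i \<in> {1..k} \<Longrightarrow> r i \<ge> 1"
  shows "top_sum k a r j + int t * a j + a i \<in> box_sums k a r"
proof -
  \<comment> \<open>For \<open>i = j\<close> the coefficient becomes \<open>t + 1\<close>, which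
    \<open>t < r j\<close> still allows.\<close>
  define c where "c m = (if m > j then r m else if m = j then t else 0) + (if m = i then 1 else 0)" for m
  have sum: "(\<Sum>m=1..k. int (c m) * a m) = top_sum k a r j + int t * a j + a i"
  proof -
    have "(\<Sum>m=1..k. int (c m) * a m) =
        (\<Sum>m=1..k. (if m \<in> {Suc j..k} then int (r m) * a m else 0)
          + (if m = j then int t * a j else 0) + (if m = i then a i else 0))"
      by (intro sum.cong) (auto simp: c_def algebra_simps)
    also have "\<dots> = (\<Sum>m=1..k. if m \<in> {Suc j..k} then int (r m) * a m else 0) + int t * a j + a i"
      using assms(1,2) by (simp add: sum.distrib)
    also have "(\<Sum>m=1..k. if m \<in> {Suc j..k} then int (r m) * a m else 0) = top_sum k a r j"
      unfolding top_sum_def by (subst sum.inter_restrict[symmetric]) (auto intro!: sum.cong)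
    finally show ?thesis .
  qed
  show ?thesis
  proof (rule box_sumsI[OF _ sum[symmetric]])
    fix m assume "m \<in> {1..k}"
    then show "c m \<le> r m" using assms(1-3) r[of m] unfolding c_def by auto
  qed
qed

text \<open>The new sums are \<open>y t + a i\<close> with \<open>1 \<le> i \<le> j\<close>.\<close>

lemma card_box_sums_step:
  assumes mono: "strict_mono_on {1..k} a" and pos: "\<And>i. i \<in> {1..k} \<Longrightarrow> a i > 0"
    and r: "\<And>i. i \<in> {1..k} \<Longrightarrow> r i \<ge> 1" and fin: "finite (box_sums k a r)"
    and j: "j \<in> {1..k}" "t < r j"
  defines "y \<equiv> \<lambda>t. top_sum k a r j + int t * a j"
  shows "card (box_sums k a r \<inter> {..y t}) + j \<le> card (box_sums k a r \<inter> {..y (Suc t)})"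
proof -
  let ?V = "box_sums k a r"
  let ?P = "(\<lambda>i. y t + a i) ` {1..j}"
  have sub: "{1..j} \<subseteq> {1..k}" using j by auto
  have inj: "inj_on a {1..j}" by (rule inj_on_subset[OF strict_mono_on_imp_inj_on[OF mono] sub])
  have "inj_on (\<lambda>i. y t + a i) {1..j}"
  proof (rule inj_onI)
    fix i i' assume "i \<in> {1..j}" "i' \<in> {1..j}" and eq: "y t + a i = y t + a i'"
    then show "i = i'" using inj_onD[OF inj] eq[unfolded add_left_cancel] by blast
  qed
  then have P: "card ?P = j" by (simp add: card_image)
  have PV: "?P \<subseteq> ?V"
  proof (rule image_subsetI)
    fix i assume "i \<in> {1..j}"
    then show "y t + a i \<in> ?V"
      unfolding y_def using j r by (intro top_sum_add_in_box_sums) auto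
  qed
  \<comment> \<open>As \<open>0 < a i \<le> a j\<close>, the new sums lie strictly above
    \<open>y t\<close> and not above \<open>y (Suc t)\<close>.\<close>
  have P_le: "?P \<subseteq> {..y (Suc t)}"
  proof (rule image_subsetI)
    fix i assume "i \<in> {1..j}"
    then have "a i \<le> a j" using strict_mono_on_leD[OF mono, of i j] j by auto
    then show "y t + a i \<in> {..y (Suc t)}" unfolding y_def by (simp add: algebra_simps)
  qed
  have "x > y t" if "x \<in> ?P" for x using that pos sub by auto
  then have disj: "(?V \<inter> {..y t}) \<inter> ?P = {}" by fastforce
  have "y t \<le> y (Suc t)" using pos[OF j(1)] unfolding y_def by (simp add: algebra_simps)
  then have "?V \<inter> {..y t} \<union> ?P \<subseteq> ?V \<inter> {..y (Suc t)}" using PV P_le by auto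
  then have "card (?V \<inter> {..y t} \<union> ?P) \<le> card (?V \<inter> {..y (Suc t)})"
    using fin by (intro card_mono) auto
  moreover have "card (?V \<inter> {..y t} \<union> ?P) = card (?V \<inter> {..y t}) + card ?P"
    using fin disj by (intro card_Un_disjoint) auto
  ultimately show ?thesis using P by simp
qed

text \<open>The \<open>h\<close>-fold sums do not exceed \<open>h * a k\<close>. From there the
  climb uses the remaining \<open>r k - h\<close> copies of \<open>a k\<close> and then all copies
  of each smaller \<open>a j\<close>, gaining \<open>j\<close> sums per copy.\<close>

lemma card_box_sums_ge:
  assumes mono: "strict_mono_on {1..k} a" and pos: "\<And>i. i \<in> {1..k} \<Longrightarrow> a i > 0"
    and r: "\<And>i. i \<in> {1..k} \<Longrightarrow> r i \<ge> 1" and fin: "finite (box_sums k a r)"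
    and "k \<ge> 1" and h: "\<And>i. i \<in> {1..k} \<Longrightarrow> h \<le> r i"
  shows "card (nfold h (a ` {1..k} \<union> {0})) + (\<Sum>i=1..k-1. i * r i) + k * (r k - h)
    \<le> card (box_sums k a r)"
proof -
  let ?V = "box_sums k a r"
  define N where "N y = card (?V \<inter> {..y})" for y
  let ?T = "top_sum k a r"
  have N: "N (?T j + int s * a j) + j * (t - s) \<le> N (?T j + int t * a j)"
    if "j \<in> {1..k}" "s \<le> t" "t \<le> r j" for j s t
    using that(2,3)
  proof (induction t rule: dec_induct)
    case (step t)
    have "N (?T j + int t * a j) + j \<le> N (?T j + int (Suc t) * a j)"
      unfolding N_def using step card_box_sums_step[OF mono pos r fin that(1), of t] by auto
    moreover have "j * (Suc t - s) = j * (t - s) + j"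
      using step by (simp add: Suc_diff_le)
    ultimately show ?case using step by simp
  qed simp
  \<comment> \<open>The end of stage \<open>j\<close> is the start of stage \<open>j - 1\<close>, so
    the gains add up.\<close>
  have T: "?T (j - 1) = ?T j + int (r j) * a j" if "j \<in> {1..k}" for j
    unfolding top_sum_def using that by (subst sum.atLeast_Suc_atMost) auto
  have sum: "N (?T j) + (\<Sum>i=1..j. i * r i) \<le> N (?T 0)" if "j \<le> k" for j
    using that
  proof (induction j)
    case (Suc j)
    have "N (?T (Suc j)) + Suc j * r (Suc j) \<le> N (?T j)"
      using N[of "Suc j" 0 "r (Suc j)"] T[of "Suc j"] Suc.prems by simp
    then show ?case using Suc by simp
  qed simp
  have k: "k \<in> {1..k}" using \<open>k \<ge> 1\<close> by simp
  have "card (nfold h (a ` {1..k} \<union> {0})) \<le> N (int h * a k)"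
    unfolding N_def
  proof (rule card_mono)
    show "finite (?V \<inter> {..int h * a k})" using fin by simp
    have "x \<le> a k" if "x \<in> a ` {1..k} \<union> {0}" for x
      using that pos[OF k] strict_mono_on_leD[OF mono _ k] by force
    moreover have "nfold h (a ` {1..k} \<union> {0}) \<subseteq> ?V"
      using strict_mono_on_imp_inj_on[OF mono] pos h by (intro nfold_subset_box_sums) force+
    ultimately show "nfold h (a ` {1..k} \<union> {0}) \<subseteq> ?V \<inter> {..int h * a k}"
      using nfold_le[of "a ` {1..k} \<union> {0}" "a k"] by blast
  qed
  \<comment> \<open>Stage \<open>k\<close> starts at \<open>top_sum k a r k = 0\<close> but is
    entered only after \<open>h\<close> copies, where the \<open>h\<close>-fold sumset has been
    counted.\<close>
  moreover have "N (int h * a k) + k * (r k - h) \<le> N (?T (k - 1))"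
    using N[OF k h[OF k] order_refl] T[OF k] by (simp add: top_sum_def)
  moreover have "N (?T (k - 1)) + (\<Sum>i=1..k-1. i * r i) \<le> N (?T 0)" by (rule sum) simp
  moreover have "N (?T 0) \<le> card ?V" unfolding N_def using fin by (intro card_mono) auto
  ultimately show ?thesis by linarith
qed

theorem theorem4p4:
  fixes AA :: "int list" and k :: nat and a :: "nat \<Rightarrow> int" and r :: "nat \<Rightarrow> nat"
    and A :: "int set" and rmin :: nat
  assumes "k \<ge> 1"
    and "seq_with_mult AA k a r"
    and "\<forall>i\<in>{1..k}. a i > 0"
    and "strict_mono_on {1..k} a"
    and "\<forall>i\<in>{1..k}. r i \<ge> 2"
    and "A = a ` {1..k}"
    and "Gcd A = 1"
    and "rmin = Min (r ` {1..k})"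
  shows "int (card (subseq_sums AA)) \<ge>
           int (card (sumset_fold (rmin - 1) (A \<union> {0})))
           + min (a k) (int rmin * (int k - 1) + 1) - 1
           + (\<Sum>i=1..k-1. int i * int (r i))
           + int k * (int (r k) - int rmin)"
proof -
  have inj: "inj_on a {1..k}" using assms(2) unfolding seq_with_mult_def by blast
  have k: "k \<in> {1..k}" using \<open>k \<ge> 1\<close> by simp
  have pos: "a i > 0" if "i \<in> {1..k}" for i using assms(3) that by blast
  have r2: "r i \<ge> 2" if "i \<in> {1..k}" for i using assms(5) that by blast
  have rmin: "rmin \<le> r i" if "i \<in> {1..k}" for i using that unfolding assms(8) by simp
  have "rmin \<in> r ` {1..k}" unfolding assms(8) using k by (intro Min_in) auto
  then have rmin1: "rmin \<ge> 1" using r2 by fastforce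
  define B where "B = A \<union> {0}"
  have "0 \<notin> A" unfolding assms(6) using pos by fastforce
  then have cardB: "card B = Suc k"
    unfolding B_def assms(6) using card_image[OF inj] by simp
  have le: "a i \<le> a k" if "i \<in> {1..k}" for i
    using strict_mono_on_leD[OF assms(4) that k] that by simp
  have "x \<in> {0..a k}" if "x \<in> B" for x
    using that pos[OF k] le pos unfolding B_def assms(6) by (auto simp: less_imp_le)
  then have B_sub: "B \<subseteq> {0..a k}" by blast
  have "Gcd B = 1" unfolding B_def using assms(7) by simp
  then have lev: "card (nfold (rmin - 1) B) + min (nat (a k)) (rmin * (k - 1) + 1) \<le> card (nfold rmin B)"
    using lev[OF B_sub _ _ pos[OF k] _ rmin1 cardB] k unfolding B_def assms(6) by simp
  have sub: "box_sums k a r \<subseteq> insert 0 (subseq_sums AA)"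
    by (rule box_sums_subset[OF assms(2)])
  have fin: "finite (box_sums k a r)"
    by (rule finite_subset[OF sub]) (simp add: finite_subseq_sums)
  have r1: "r i \<ge> 1" if "i \<in> {1..k}" for i using r2[OF that] by simp
  have "card (box_sums k a r) \<le> card (insert 0 (subseq_sums AA))"
    by (rule card_mono[OF _ sub]) (simp add: finite_subseq_sums)
  \<comment> \<open>The extra element is the empty sum \<open>0\<close>; it becomes the
    \<open>- 1\<close> of the claim.\<close>
  also have "\<dots> \<le> card (subseq_sums AA) + 1"
    by (simp add: card_insert_if finite_subseq_sums)
  finally have "card (nfold (rmin - 1) B) + min (nat (a k)) (rmin * (k - 1) + 1)
      + (\<Sum>i=1..k-1. i * r i) + k * (r k - rmin) \<le> card (subseq_sums AA) + 1"
    using card_box_sums_ge[OF assms(4) pos r1 fin \<open>k \<ge> 1\<close> rmin] lev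
    unfolding B_def assms(6) by linarith
  then have "int (card (nfold (rmin - 1) B) + min (nat (a k)) (rmin * (k - 1) + 1)
      + (\<Sum>i=1..k-1. i * r i) + k * (r k - rmin)) \<le> int (card (subseq_sums AA) + 1)"
    by (simp only: of_nat_le_iff)
  \<comment> \<open>Neither \<open>nat\<close> nor truncated subtraction loses anything, by
    \<open>a k > 0\<close>, \<open>k \<ge> 1\<close> and \<open>rmin \<le> r k\<close>.\<close>
  moreover have "int (min (nat (a k)) (rmin * (k - 1) + 1)) = min (a k) (int rmin * (int k - 1) + 1)"
    using pos[OF k] \<open>k \<ge> 1\<close> by (simp add: of_nat_min of_nat_diff)
  moreover have "int (k * (r k - rmin)) = int k * (int (r k) - int rmin)"
    using rmin[OF k] by (simp add: of_nat_diff)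
  moreover have "int (\<Sum>i=1..k-1. i * r i) = (\<Sum>i=1..k-1. int i * int (r i))" by simp
  ultimately show ?thesis
    unfolding sumset_fold_eq_nfold B_def of_nat_add of_nat_1 by linarith
qed

end
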